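(* For every odd prime power $q$ there exists at least one special spread in $\mathrm{PG}(3,q)$ (with respect to a given symplectic polarity of $\mathrm{PG}(3,q)$).
   Context: A symplectic polarity $\zeta$ of $\mathrm{PG}(3,q)$ is a polarity with $x\in x^\zeta$ for every point $x$. Two points $x,y$ are orthogonal if $y\in x^\zeta$. A line $L$ is totally isotropic if $L^\zeta=L$. A spread is a set of lines of $\mathrm{PG}(3,q)$ partitioning its point set. For $q$ odd, a special spread (with respect to a given symplectic polarity $\zeta$) is a spread $S$ consisting of lines that are not totally isotropic such that for every $\ell\in S$ there is a uniquely determined line $\ell'\in S$ such that any point of $\ell$ is orthogonal to any point of $\ell'$ (that is, $\ell'=\ell^\zeta$). *)

theory Defs
  imports "HOL-Analysis.Analysis" "HOL-Number_Theory.Prime_Powers"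
begin

text \<open>
  \<open>PG(3,q)\<close> is the lattice of linear subspaces of \<open>F ^ 4\<close>, where \<open>F\<close> is a field with \<open>q\<close> elements;
  projective points, lines and planes are the subspaces of vector space dimension 1, 2 and 3.
  Incidence is inclusion, so the projective relation \<open>x \<in> L\<close> reads \<open>x \<subseteq> L\<close>.
\<close>

definition pg_points :: "('a::field ^ 4) set set" where
  "pg_points = {x. vec.subspace x \<and> vec.dim x = 1}"

definition pg_lines :: "('a::field ^ 4) set set" where
  "pg_lines = {L. vec.subspace L \<and> vec.dim L = 2}"

text \<open>
  A polarity is an inclusion-reversing permutation of the subspaces of order 2. It cannot be the
  identity, since it exchanges the zero subspace with the whole space.
  Its values on sets that are not subspaces are irrelevant.
\<close>

definition polarity :: "(('a::field ^ 4) set \<Rightarrow> ('a ^ 4) set) \<Rightarrow> bool" where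
  "polarity \<zeta> \<longleftrightarrow>
     bij_betw \<zeta> {U. vec.subspace U} {U. vec.subspace U} \<and>
     (\<forall>U W. vec.subspace U \<longrightarrow> vec.subspace W \<longrightarrow> (U \<subseteq> W \<longleftrightarrow> \<zeta> W \<subseteq> \<zeta> U)) \<and>
     (\<forall>U. vec.subspace U \<longrightarrow> \<zeta> (\<zeta> U) = U)"

definition symplectic_polarity :: "(('a::field ^ 4) set \<Rightarrow> ('a ^ 4) set) \<Rightarrow> bool" where
  "symplectic_polarity \<zeta> \<longleftrightarrow> polarity \<zeta> \<and> (\<forall>x\<in>pg_points. x \<subseteq> \<zeta> x)"

definition orthogonal_points ::
    "(('a::field ^ 4) set \<Rightarrow> ('a ^ 4) set) \<Rightarrow> ('a ^ 4) set \<Rightarrow> ('a ^ 4) set \<Rightarrow> bool" where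
  "orthogonal_points \<zeta> x y \<longleftrightarrow> y \<subseteq> \<zeta> x"

definition totally_isotropic ::
    "(('a::field ^ 4) set \<Rightarrow> ('a ^ 4) set) \<Rightarrow> ('a ^ 4) set \<Rightarrow> bool" where
  "totally_isotropic \<zeta> L \<longleftrightarrow> \<zeta> L = L"

definition spread :: "('a::field ^ 4) set set \<Rightarrow> bool" where
  "spread S \<longleftrightarrow> S \<subseteq> pg_lines \<and> (\<forall>x\<in>pg_points. \<exists>!L. L \<in> S \<and> x \<subseteq> L)"

definition special_spread ::
    "(('a::field ^ 4) set \<Rightarrow> ('a ^ 4) set) \<Rightarrow> ('a ^ 4) set set \<Rightarrow> bool" where
  "special_spread \<zeta> S \<longleftrightarrow>
     spread S \<and>
     (\<forall>L\<in>S. \<not> totally_isotropic \<zeta> L) \<and>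
     (\<forall>L\<in>S. \<exists>!L'. L' \<in> S \<and>
        (\<forall>x\<in>pg_points. \<forall>y\<in>pg_points. x \<subseteq> L \<longrightarrow> y \<subseteq> L' \<longrightarrow> orthogonal_points \<zeta> x y))"

end

(* Orthogonality with respect to a symplectic polarity is the relation "y lies in the image of x".
   In a basis consisting of two hyperbolic pairs spanning mutually orthogonal lines, each point x
   determines this relation up to one scalar r(x), the ratio of the two 2 x 2 determinants; symmetry
   of the relation forces r to be constant, so orthogonality is r det12 + det34 = 0.

   Identify F^4 with K^2, where K = F(sqrt d) and d is a nonsquare. With N the norm of K, the
   totally isotropic lines of the regular spread of all y = m x and x = 0 are the y = m x with
   N(m) = - r. They form a regulus; replacing it by the opposite regulus of all y = m x^q with
   N(m) = - r gives a (Hall) spread. The polarity exchanges x = 0 with y = 0, maps y = m x to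
   y = k m x with k = - r / N(m), and maps y = m x^q to y = - m x^q, so as q is odd no line is fixed. *)
theory Submission
  imports Defs "HOL-Number_Theory.Residues"
begin

section \<open>Coordinates of F^4 and the two 2 x 2 determinants\<close>

definition vec4 :: "'a \<Rightarrow> 'a \<Rightarrow> 'a \<Rightarrow> 'a \<Rightarrow> 'a::field ^ 4" where
  "vec4 a b c e = (\<chi> i. if i = 1 then a else if i = 2 then b else if i = 3 then c else e)"

lemma vec4_nth [simp]:
  "vec4 a b c e $ 1 = a" "vec4 a b c e $ 2 = b" "vec4 a b c e $ 3 = c" "vec4 a b c e $ 4 = e"
  by (simp_all add: vec4_def)

lemma vec4_eq_iff: "(x::'a::field ^ 4) = y \<longleftrightarrow> x$1 = y$1 \<and> x$2 = y$2 \<and> x$3 = y$3 \<and> x$4 = y$4"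
  by (simp add: vec_eq_iff forall_4)

definition det12 :: "'a::field ^ 4 \<Rightarrow> 'a ^ 4 \<Rightarrow> 'a" where
  "det12 x y = x$1 * y$2 - x$2 * y$1"

definition det34 :: "'a::field ^ 4 \<Rightarrow> 'a ^ 4 \<Rightarrow> 'a" where
  "det34 x y = x$3 * y$4 - x$4 * y$3"

section \<open>Orthogonality relations on vectors and their hyperbolic bases\<close>

text \<open>These are the properties that a symplectic polarity \<zeta> gives to the relation
  \<open>y \<in> \<zeta> (vec.span {x})\<close>; a form is recovered from them later. The assumption
  \<open>hyperplane\<close> says that the vectors orthogonal to \<open>x\<close>, together with any
  one other vector, span the space.\<close>

locale null_relation =
  fixes perp :: "'a::field ^ 4 \<Rightarrow> 'a ^ 4 \<Rightarrow> bool"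
  assumes perp_sym: "perp x y \<Longrightarrow> perp y x"
    and perp_self: "perp x x"
    and subspace_perp: "vec.subspace {y. perp x y}"
    and nondegenerate: "x \<noteq> 0 \<Longrightarrow> \<exists>y. \<not> perp x y"
    and hyperplane: "\<not> perp x z \<Longrightarrow> \<exists>c. perp x (y - c *s z)"
begin

lemma perp_zero: "perp x 0" "perp 0 x"
  using vec.subspace_0[OF subspace_perp, of x] perp_sym by auto

lemma perp_add: "perp x y \<Longrightarrow> perp x z \<Longrightarrow> perp x (y + z)"
  using vec.subspace_add[OF subspace_perp[of x]] by auto

lemma perp_scale: "perp x y \<Longrightarrow> perp x (c *s y)"
  using vec.subspace_scale[OF subspace_perp[of x]] by auto

lemma perp_diff: "perp x y \<Longrightarrow> perp x z \<Longrightarrow> perp x (y - z)"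
  using vec.subspace_diff[OF subspace_perp[of x]] by auto

lemma perp_add_cancel: "perp x y \<Longrightarrow> perp x (y + z) \<longleftrightarrow> perp x z"
  using perp_add[of x y z] perp_diff[of x "y + z" y] by auto

lemma perp_scale_iff: "perp x (c *s y) \<longleftrightarrow> c = 0 \<or> perp x y"
proof (cases "c = 0")
  case False
  then have "y = inverse c *s (c *s y)" by (simp add: vector_smult_assoc)
  then show ?thesis using perp_scale[of x y c] perp_scale[of x "c *s y" "inverse c"] False by auto
qed (simp add: perp_zero)

text \<open>A change of coordinates: an arbitrary basis becomes the standard one when
  \<open>T\<close> maps the standard basis to it.\<close>

lemma pullback:
  assumes T: "Vector_Spaces.linear (*s) (*s) T" and "bij T"
  shows "null_relation (\<lambda>x y. perp (T x) (T y))"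
proof
  interpret T: Vector_Spaces.linear "(*s)" "(*s)" T by (fact T)
  show "vec.subspace {y. perp (T x) (T y)}" for x
    by (rule vec.subspaceI) (auto simp: T.zero T.add T.scale perp_zero perp_add perp_scale)
  show "\<exists>y. \<not> perp (T x) (T y)" if "x \<noteq> 0" for x
  proof -
    have "T x \<noteq> 0" using that \<open>bij T\<close> T.zero by (metis bij_pointE)
    then show ?thesis using nondegenerate \<open>bij T\<close> by (metis bij_pointE)
  qed
  show "\<exists>c. perp (T x) (T (y - c *s z))" if "\<not> perp (T x) (T z)" for x y z
    using hyperplane[OF that, of "T y"] by (simp add: T.diff T.scale)
qed (auto intro: perp_sym perp_self)

text \<open>The vectors orthogonal to \<open>x\<close> form the whole space or a hyperplane. In the
  second case fix \<open>z\<close> outside; the multiple of \<open>z\<close> to be subtracted from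
  \<open>y\<close> to make it orthogonal to \<open>x\<close> depends linearly on \<open>y\<close>,
  so its values \<open>c i\<close> at the standard basis are the coefficients.\<close>

lemma ex_functional: "\<exists>\<alpha>::'a ^ 4. \<forall>y. perp x y \<longleftrightarrow> (\<Sum>i\<in>UNIV. \<alpha>$i * y$i) = 0"
proof (cases "\<exists>z. \<not> perp x z")
  case True
  then obtain z where z: "\<not> perp x z" by auto
  then have "\<forall>i. \<exists>c. perp x (axis i 1 - c *s z)" using hyperplane by blast
  then obtain c where c: "\<And>i. perp x (axis i 1 - c i *s z)" by metis
  have "perp x y \<longleftrightarrow> (\<Sum>i\<in>UNIV. c i * y$i) = 0" for y
  proof -
    have "perp x (\<Sum>i\<in>UNIV. y$i *s (axis i 1 - c i *s z))"
      using vec.subspace_sum[OF subspace_perp[of x], of UNIV "\<lambda>i. y$i *s (axis i 1 - c i *s z)"]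
        perp_scale[OF c] by (simp only: mem_Collect_eq)
    then have "perp x ((\<Sum>i\<in>UNIV. y$i *s (axis i 1 - c i *s z)) + (\<Sum>i\<in>UNIV. c i * y$i) *s z)
        \<longleftrightarrow> (\<Sum>i\<in>UNIV. c i * y$i) = 0"
      using z by (simp only: perp_add_cancel perp_scale_iff) blast
    moreover have "(\<Sum>i\<in>UNIV. y$i *s (axis i 1 - c i *s z)) + (\<Sum>i\<in>UNIV. c i * y$i) *s z = y"
      unfolding vec4_eq_iff sum_4 by (simp add: axis_def algebra_simps)
    ultimately show ?thesis by simp
  qed
  then have "\<forall>y. perp x y \<longleftrightarrow> (\<Sum>i\<in>UNIV. (\<chi> i. c i)$i * y$i) = 0" by simp
  then show ?thesis by blast
next
  case False
  then have "\<forall>y. perp x y \<longleftrightarrow> (\<Sum>i\<in>UNIV. (0::'a^4)$i * y$i) = 0" by simp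
  then show ?thesis by blast
qed

text \<open>A symplectic Gram-Schmidt process: two non-orthogonal vectors \<open>e1\<close>,
  \<open>e2\<close> split off, and the vectors orthogonal to both contain a second such pair
  \<open>e3\<close>, \<open>e4\<close>.\<close>

lemma ex_hyperbolic_basis:
  "\<exists>T. Vector_Spaces.linear (*s) (*s) T \<and> bij T \<and>
    (\<forall>x y. (x$3 = 0 \<and> x$4 = 0 \<and> y$1 = 0 \<and> y$2 = 0) \<longrightarrow> perp (T x) (T y)) \<and>
    \<not> perp (T (vec4 1 0 0 0)) (T (vec4 0 1 0 0)) \<and> \<not> perp (T (vec4 0 0 1 0)) (T (vec4 0 0 0 1))"
proof -
  obtain e1 :: "'a ^ 4" where "e1 \<noteq> 0"
    by (rule that[of "axis 1 1"]) (simp add: axis_eq_0_iff)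
  then obtain e2 where e12: "\<not> perp e1 e2" using nondegenerate by blast
  then have e21: "\<not> perp e2 e1" using perp_sym by blast
  \<comment> \<open>The coefficient of \<open>e2\<close> is chosen for orthogonality to
    \<open>e1\<close> and vice versa. The other summand does no harm, since every vector is
    orthogonal to itself.\<close>
  have decomp: "\<exists>a b m. v = a *s e1 + b *s e2 + m \<and> perp e1 m \<and> perp e2 m" for v
  proof -
    obtain b where b: "perp e1 (v - b *s e2)" using hyperplane[OF e12] by blast
    obtain a where a: "perp e2 (v - a *s e1)" using hyperplane[OF e21] by blast
    have "perp e1 (v - b *s e2 - a *s e1)" by (intro perp_diff perp_scale perp_self b)
    moreover have "perp e2 (v - a *s e1 - b *s e2)" by (intro perp_diff perp_scale perp_self a)
    moreover have "v = a *s e1 + b *s e2 + (v - a *s e1 - b *s e2)" by simp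
    moreover have "v - b *s e2 - a *s e1 = v - a *s e1 - b *s e2" by simp
    ultimately show ?thesis by (simp only:) blast
  qed
  \<comment> \<open>A vector outside the plane of \<open>e1\<close> and \<open>e2\<close> has a
    nonzero component orthogonal to both.\<close>
  obtain e3 where e3: "e3 \<noteq> 0" "perp e1 e3" "perp e2 e3"
  proof -
    have "\<not> UNIV \<subseteq> vec.span {e1, e2}"
    proof
      assume "UNIV \<subseteq> vec.span {e1, e2}"
      then have "vec.dim (UNIV :: ('a^4) set) \<le> card {e1, e2}" by (intro vec.dim_le_card) auto
      then show False using card_insert_le_m1[of 2 "{e2}" e1] unfolding vec_dim_card by simp
    qed
    then obtain v where v: "v \<notin> vec.span {e1, e2}" by auto
    obtain a b m where m: "v = a *s e1 + b *s e2 + m" "perp e1 m" "perp e2 m"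
      using decomp by blast
    have "a *s e1 + b *s e2 \<in> vec.span {e1, e2}"
      by (intro vec.span_add vec.span_scale vec.span_base) auto
    with v m(1) have "m \<noteq> 0" by auto
    with m that show ?thesis by blast
  qed
  then obtain y where y: "\<not> perp e3 y" using nondegenerate by blast
  \<comment> \<open>The part of \<open>y\<close> in the plane of \<open>e1\<close> and
    \<open>e2\<close> is orthogonal to \<open>e3\<close>, so the rest of \<open>y\<close> stays
    non-orthogonal to \<open>e3\<close>.\<close>
  obtain a b e4 where e4: "y = a *s e1 + b *s e2 + e4" "perp e1 e4" "perp e2 e4"
    using decomp by blast
  have "perp e3 (a *s e1 + b *s e2)" by (intro perp_add perp_scale e3(2,3)[THEN perp_sym])
  with y e4(1) have e34: "\<not> perp e3 e4" using perp_add by blast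
  then have e43: "\<not> perp e4 e3" using perp_sym by blast
  define T where "T x = x$1 *s e1 + x$2 *s e2 + x$3 *s e3 + x$4 *s e4" for x :: "'a^4"
  have lin: "Vector_Spaces.linear (*s) (*s) T"
    by unfold_locales (simp_all add: T_def vec_eq_iff algebra_simps)
  interpret T: Vector_Spaces.linear "(*s)" "(*s)" T by (fact lin)
  have inj: "inj T"
  proof (subst T.inj_iff_eq_0, intro allI impI)
    fix x assume 0: "T x = 0"
    \<comment> \<open>Testing \<open>T x = 0\<close> against a basis vector isolates the coefficient
      of its hyperbolic partner, since the three other summands are orthogonal to it.\<close>
    have p: "perp e (T x)" for e using 0 by (simp add: perp_zero)
    note perps = perp_self e3 e4(2,3) e3(2,3)[THEN perp_sym] e4(2,3)[THEN perp_sym]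
    have "T x = (x$1 *s e1 + x$3 *s e3 + x$4 *s e4) + x$2 *s e2" by (simp add: T_def)
    moreover have "perp e1 (x$1 *s e1 + x$3 *s e3 + x$4 *s e4)"
      by (intro perp_add perp_scale perps)
    ultimately have 2: "x$2 = 0" using p[of e1] by (simp only: perp_add_cancel perp_scale_iff simp_thms e12)
    have "T x = (x$2 *s e2 + x$3 *s e3 + x$4 *s e4) + x$1 *s e1" by (simp add: T_def)
    moreover have "perp e2 (x$2 *s e2 + x$3 *s e3 + x$4 *s e4)"
      by (intro perp_add perp_scale perps)
    ultimately have 1: "x$1 = 0" using p[of e2] by (simp only: perp_add_cancel perp_scale_iff simp_thms e21)
    have "T x = (x$1 *s e1 + x$2 *s e2 + x$3 *s e3) + x$4 *s e4" by (simp add: T_def)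
    moreover have "perp e3 (x$1 *s e1 + x$2 *s e2 + x$3 *s e3)"
      by (intro perp_add perp_scale perps)
    ultimately have 4: "x$4 = 0" using p[of e3] by (simp only: perp_add_cancel perp_scale_iff simp_thms e34)
    have "T x = (x$1 *s e1 + x$2 *s e2 + x$4 *s e4) + x$3 *s e3" by (simp add: T_def)
    moreover have "perp e4 (x$1 *s e1 + x$2 *s e2 + x$4 *s e4)"
      by (intro perp_add perp_scale perps)
    ultimately have 3: "x$3 = 0" using p[of e4] by (simp only: perp_add_cancel perp_scale_iff simp_thms e43)
    show "x = 0" using 1 2 3 4 by (simp add: vec4_eq_iff)
  qed
  then have "bij T" using vec.linear_inj_imp_surj[OF lin] by (simp add: bij_def)
  moreover have "perp (T x) (T y)" if "x$3 = 0 \<and> x$4 = 0 \<and> y$1 = 0 \<and> y$2 = 0" for x y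
  proof -
    have *: "perp e (T y)" if "e = e1 \<or> e = e2" for e
      using that \<open>x$3 = 0 \<and> _\<close> e3 e4 by (auto simp: T_def intro!: perp_add perp_scale)
    have "perp (T y) (x$1 *s e1 + x$2 *s e2)"
      by (intro perp_add perp_scale) (use * perp_sym in blast)+
    then show ?thesis using that perp_sym by (simp add: T_def)
  qed
  moreover have "\<not> perp (T (vec4 1 0 0 0)) (T (vec4 0 1 0 0))" using e12 by (simp add: T_def)
  moreover have "\<not> perp (T (vec4 0 0 1 0)) (T (vec4 0 0 0 1))" using e34 by (simp add: T_def)
  ultimately show ?thesis using lin by blast
qed

end

section \<open>The form behind a null relation in hyperbolic coordinates\<close>

locale hyperbolic_null_relation = null_relation +
  assumes perp_12_34: "x$3 = 0 \<Longrightarrow> x$4 = 0 \<Longrightarrow> y$1 = 0 \<Longrightarrow> y$2 = 0 \<Longrightarrow> perp x y"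
    and not_perp_12: "\<not> perp (vec4 1 0 0 0) (vec4 0 1 0 0)"
    and not_perp_34: "\<not> perp (vec4 0 0 1 0) (vec4 0 0 0 1)"
begin

lemma perp_12_cancel:
  assumes "y$3 = 0" "y$4 = 0"
  shows "perp x y \<longleftrightarrow> perp (vec4 (x$1) (x$2) 0 0) y"
proof -
  have "x = vec4 0 0 (x$3) (x$4) + vec4 (x$1) (x$2) 0 0" by (simp add: vec4_eq_iff)
  moreover have "perp y (vec4 0 0 (x$3) (x$4))" using assms by (intro perp_12_34) auto
  ultimately show ?thesis using perp_add_cancel perp_sym by metis
qed

lemma perp_34_cancel:
  assumes "y$1 = 0" "y$2 = 0"
  shows "perp x y \<longleftrightarrow> perp (vec4 0 0 (x$3) (x$4)) y"
proof -
  have "x = vec4 (x$1) (x$2) 0 0 + vec4 0 0 (x$3) (x$4)" by (simp add: vec4_eq_iff)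
  moreover have "perp y (vec4 (x$1) (x$2) 0 0)" using assms
    by (intro perp_sym[OF perp_12_34]) auto
  ultimately show ?thesis using perp_add_cancel perp_sym by metis
qed

text \<open>The functional of \<open>ex_functional\<close> splits into halves on coordinates 1, 2
  and 3, 4. Each half kills the matching half of \<open>x\<close>, so it is a nonzero multiple of
  the determinant with that half; only the ratio of the two multiples matters.\<close>

lemma ex_pointwise_form: "\<exists>r. r \<noteq> 0 \<and> (\<forall>y. perp x y \<longleftrightarrow> r * det12 x y + det34 x y = 0)"
proof -
  obtain \<alpha> :: "'a^4" where \<alpha>: "\<And>y. perp x y \<longleftrightarrow> \<alpha>$1 * y$1 + \<alpha>$2 * y$2 + \<alpha>$3 * y$3 + \<alpha>$4 * y$4 = 0"
    using ex_functional[of x] by (auto simp: sum_4)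
  have not_perp_21: "\<not> perp (vec4 0 1 0 0) (vec4 1 0 0 0)" and not_perp_43: "\<not> perp (vec4 0 0 0 1) (vec4 0 0 1 0)"
    using not_perp_12 not_perp_34 perp_sym by blast+
  \<comment> \<open>The functionals on a plane that kill a nonzero \<open>(u, v)\<close> are the
    multiples of \<open>(- v, u)\<close>. If \<open>u\<close> and \<open>v\<close> vanish then so do
    \<open>a\<close> and \<open>b\<close>, and \<open>l\<close> is set to 1.\<close>
  have proportional: "\<exists>l. l \<noteq> 0 \<and> a = - l * v \<and> b = l * u"
    if "a * u + b * v = 0" "a = 0 \<and> b = 0 \<longleftrightarrow> u = 0 \<and> v = 0" for a b u v :: 'a
  proof (cases "u = 0")
    case True
    show ?thesis
    proof (cases "v = 0")
      case False
      with True that show ?thesis by (intro exI[of _ "- a / v"]) auto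
    qed (use True that in \<open>auto intro!: exI[of _ 1]\<close>)
  next
    case False
    with that have "a = - (b / u) * v" by (simp add: field_simps add_eq_0_iff)
    moreover from this False that have "b \<noteq> 0" by auto
    ultimately show ?thesis using False by (intro exI[of _ "b / u"]) auto
  qed
  \<comment> \<open>Against its own half only that half of \<open>x\<close> counts, and it is
    orthogonal to itself. The tests on the four basis vectors then tell which coefficients of
    \<open>\<alpha>\<close> vanish.\<close>
  have "perp x (vec4 (x$1) (x$2) 0 0)" by (simp add: perp_12_cancel perp_self)
  moreover have "perp x (vec4 0 0 (x$3) (x$4))" by (simp add: perp_34_cancel perp_self)
  moreover have "perp x (vec4 1 0 0 0) \<longleftrightarrow> x$2 = 0"
  proof -
    have "vec4 (x$1) (x$2) 0 0 = x$1 *s vec4 1 0 0 0 + x$2 *s vec4 0 1 0 0" by (simp add: vec4_eq_iff)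
    then have "perp (vec4 1 0 0 0) (vec4 (x$1) (x$2) 0 0) \<longleftrightarrow> x$2 = 0"
      using not_perp_12 by (simp only: perp_add_cancel[OF perp_scale[OF perp_self]] perp_scale_iff) blast
    then show ?thesis using perp_12_cancel[of "vec4 1 0 0 0" x] perp_sym by auto
  qed
  moreover have "perp x (vec4 0 1 0 0) \<longleftrightarrow> x$1 = 0"
  proof -
    have "vec4 (x$1) (x$2) 0 0 = x$2 *s vec4 0 1 0 0 + x$1 *s vec4 1 0 0 0" by (simp add: vec4_eq_iff)
    then have "perp (vec4 0 1 0 0) (vec4 (x$1) (x$2) 0 0) \<longleftrightarrow> x$1 = 0"
      using not_perp_21 by (simp only: perp_add_cancel[OF perp_scale[OF perp_self]] perp_scale_iff) blast
    then show ?thesis using perp_12_cancel[of "vec4 0 1 0 0" x] perp_sym by auto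
  qed
  moreover have "perp x (vec4 0 0 1 0) \<longleftrightarrow> x$4 = 0"
  proof -
    have "vec4 0 0 (x$3) (x$4) = x$3 *s vec4 0 0 1 0 + x$4 *s vec4 0 0 0 1" by (simp add: vec4_eq_iff)
    then have "perp (vec4 0 0 1 0) (vec4 0 0 (x$3) (x$4)) \<longleftrightarrow> x$4 = 0"
      using not_perp_34 by (simp only: perp_add_cancel[OF perp_scale[OF perp_self]] perp_scale_iff) blast
    then show ?thesis using perp_34_cancel[of "vec4 0 0 1 0" x] perp_sym by auto
  qed
  moreover have "perp x (vec4 0 0 0 1) \<longleftrightarrow> x$3 = 0"
  proof -
    have "vec4 0 0 (x$3) (x$4) = x$4 *s vec4 0 0 0 1 + x$3 *s vec4 0 0 1 0" by (simp add: vec4_eq_iff)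
    then have "perp (vec4 0 0 0 1) (vec4 0 0 (x$3) (x$4)) \<longleftrightarrow> x$3 = 0"
      using not_perp_43 by (simp only: perp_add_cancel[OF perp_scale[OF perp_self]] perp_scale_iff) blast
    then show ?thesis using perp_34_cancel[of "vec4 0 0 0 1" x] perp_sym by auto
  qed
  ultimately have *: "\<alpha>$1 * x$1 + \<alpha>$2 * x$2 = 0" "\<alpha>$3 * x$3 + \<alpha>$4 * x$4 = 0"
    "\<alpha>$1 = 0 \<longleftrightarrow> x$2 = 0" "\<alpha>$2 = 0 \<longleftrightarrow> x$1 = 0" "\<alpha>$3 = 0 \<longleftrightarrow> x$4 = 0" "\<alpha>$4 = 0 \<longleftrightarrow> x$3 = 0"
    by (simp_all add: \<alpha>)
  obtain l where l: "l \<noteq> 0" "\<alpha>$1 = - l * x$2" "\<alpha>$2 = l * x$1"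
    using proportional[OF *(1)] *(3,4) by auto
  obtain m where m: "m \<noteq> 0" "\<alpha>$3 = - m * x$4" "\<alpha>$4 = m * x$3"
    using proportional[OF *(2)] *(5,6) by auto
  have "perp x y \<longleftrightarrow> l / m * det12 x y + det34 x y = 0" for y
  proof -
    have "\<alpha>$1 * y$1 + \<alpha>$2 * y$2 + \<alpha>$3 * y$3 + \<alpha>$4 * y$4 = m * (l / m * det12 x y + det34 x y)"
      using m(1) unfolding l m det12_def det34_def by (simp add: algebra_simps)
    then show ?thesis using \<alpha>[of y] m(1) by simp
  qed
  then show ?thesis using l(1) m(1) by (intro exI[of _ "l / m"]) auto
qed

text \<open>Two orthogonal vectors with nonzero \<open>det12\<close> share their scalar, because the
  relation is symmetric. Starting from \<open>vec4 1 0 1 0\<close>, chains of such pairs reach every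
  vector except those with a vanishing half, for which every nonzero scalar serves.\<close>

lemma ex_form: "\<exists>r. r \<noteq> 0 \<and> (\<forall>x y. perp x y \<longleftrightarrow> r * det12 x y + det34 x y = 0)"
proof -
  define P where "P x r \<longleftrightarrow> (\<forall>y. perp x y \<longleftrightarrow> r * det12 x y + det34 x y = 0)" for x r
  obtain r where r: "r \<noteq> 0" "P (vec4 1 0 1 0) r" using ex_pointwise_form P_def by blast
  have ex: "\<exists>s. s \<noteq> 0 \<and> P x s" for x using ex_pointwise_form P_def by blast
  have step: "P y r" if "P x r" "r * det12 x y + det34 x y = 0" "det12 x y \<noteq> 0" for x y
  proof -
    obtain s where s: "P y s" using ex by blast
    have "perp y x" using that(1,2) perp_sym unfolding P_def by blast
    then have "s * det12 y x + det34 y x = 0" using s unfolding P_def by blast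
    moreover have "det12 y x = - det12 x y" "det34 y x = - det34 x y"
      by (auto simp: det12_def det34_def)
    ultimately have "s * det12 x y = r * det12 x y" using that(2)
      by (metis add.inverse_inverse add_eq_0_iff mult_minus_right)
    with that(3) s show ?thesis by simp
  qed
  \<comment> \<open>One of the determinants vanishes here, so the equation does not depend on the
    nonzero scalar.\<close>
  have triv: "P y r" if "y$1 = 0 \<and> y$2 = 0 \<or> y$3 = 0 \<and> y$4 = 0" for y
  proof -
    obtain s where s: "s \<noteq> 0" "P y s" using ex by blast
    have "s * det12 y z + det34 y z = 0 \<longleftrightarrow> r * det12 y z + det34 y z = 0" for z
      using that s r(1) by (auto simp: det12_def det34_def)
    with s(2) show ?thesis unfolding P_def by blast
  qed
  \<comment> \<open>The determinants with the starting vector are 1 and \<open>- r\<close>;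
    \<open>a\<close> and \<open>b\<close> stay free for the next link of the chain.\<close>
  have z: "P (vec4 a 1 b (- r)) r" for a b
    using r(2) by (rule step) (auto simp: det12_def det34_def)
  have A: "P y r" if "y$2 \<noteq> 0" for y
  proof (cases "y$4 = 0")
    case False
    \<comment> \<open>\<open>a\<close> and \<open>b\<close> are solved from \<open>det12 = 1\<close>
      and \<open>det34 = - r\<close>.\<close>
    show ?thesis
      by (rule step[OF z[of "(y$1 + 1) / y$2" "- (r + r * y$3) / y$4"]])
        (use that False in \<open>auto simp: det12_def det34_def field_simps\<close>)
  next
    case True
    show ?thesis
    proof (cases "y$3 = 0")
      case False
      \<comment> \<open>Here the determinants are \<open>- y$3\<close> and
        \<open>r * y$3\<close>.\<close>
      show ?thesis
        by (rule step[OF z[of "(y$1 - y$3) / y$2" 0]])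
          (use that False True in \<open>auto simp: det12_def det34_def field_simps\<close>)
    qed (use True triv in blast)
  qed
  have "P y r" for y
  proof (cases "y$2 = 0")
    case y2: True
    show ?thesis
    proof (cases "y$1 = 0")
      case y1: False
      show ?thesis
      proof (cases "y$4 = 0")
        case y4: True
        show ?thesis
        proof (cases "y$3 = 0")
          case False
          \<comment> \<open>Here and in the case \<open>y$4 \<noteq> 0\<close> the determinants are
            \<open>- y$1\<close> and \<open>r * y$1\<close>.\<close>
          show ?thesis
            by (rule step[OF A[of "vec4 0 1 0 (- r * y$1 / y$3)"]])
              (use y1 y2 y4 False in \<open>auto simp: det12_def det34_def\<close>)
        qed (use y4 triv in blast)
      next
        case False
        show ?thesis
          by (rule step[OF z[of 0 "(r * y$1 - r * y$3) / y$4"]])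
            (use y1 y2 False in \<open>auto simp: det12_def det34_def\<close>)
      qed
    qed (use y2 triv in blast)
  qed (rule A)
  with r(1) show ?thesis unfolding P_def by blast
qed

end

section \<open>Finite fields of odd order\<close>

text \<open>2 vanishes only in characteristic 2, which would divide the order. So 1 and -1 are
  distinct with the same square, and on a finite set the non-injective squaring map cannot be
  surjective.\<close>

lemma ex_nonsquare:
  assumes "odd CARD('a::{field,finite})"
  shows "\<exists>d::'a. \<forall>x. x\<^sup>2 \<noteq> d" and "(2::'a) \<noteq> 0"
proof -
  show 2: "(2::'a) \<noteq> 0"
  proof
    assume "(2::'a) = 0"
    then have "CHAR('a) dvd 2" by (metis of_nat_eq_0_iff_char_dvd of_nat_numeral)
    then have "CHAR('a) = 2" 
      by (metis CHAR_not_1' One_nat_def prime_nat_iff two_is_prime_nat)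
    with assms show False using CHAR_dvd_CARD[where 'a='a] by simp
  qed
  have "\<not> inj (\<lambda>x::'a. x\<^sup>2)"
  proof
    assume "inj (\<lambda>x::'a. x\<^sup>2)"
    then have "(1::'a) = -1" by (rule injD) simp
    with 2 show False by (metis add.right_inverse one_add_one)
  qed
  then have "\<not> surj (\<lambda>x::'a. x\<^sup>2)" using finite_UNIV_surj_inj[OF finite] by (rule contrapos_nn)
  then show "\<exists>d::'a. \<forall>x. x\<^sup>2 \<noteq> d" by (metis surjI surj_def)
qed

section \<open>Lines as graphs of linear maps and their orthogonal lines\<close>

text \<open>The vector version of \<open>special_spread\<close>: the partner of \<open>L\<close> is
  named outright as the set of vectors orthogonal to all of \<open>L\<close>, and a pair of
  non-orthogonal vectors keeps \<open>L\<close> from being totally isotropic.\<close>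

definition perp_spread :: "('a::field ^ 4 \<Rightarrow> 'a ^ 4 \<Rightarrow> bool) \<Rightarrow> ('a ^ 4) set set \<Rightarrow> bool" where
  "perp_spread perp S \<longleftrightarrow>
     S \<subseteq> pg_lines \<and> (\<forall>v. v \<noteq> 0 \<longrightarrow> (\<exists>!L. L \<in> S \<and> v \<in> L)) \<and>
     (\<forall>L\<in>S. {v. \<forall>u\<in>L. perp u v} \<in> S \<and> (\<exists>u\<in>L. \<exists>v\<in>L. \<not> perp u v))"

text \<open>The graph of the linear map with matrix rows \<open>(a, b)\<close> and
  \<open>(c, e)\<close> from coordinates 1, 2 to coordinates 3, 4; these are the lines skew to
  \<open>vertical\<close>.\<close>

definition graph4 :: "'a \<Rightarrow> 'a \<Rightarrow> 'a \<Rightarrow> 'a \<Rightarrow> ('a::field ^ 4) set" where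
  "graph4 a b c e = {v. v$3 = a * v$1 + b * v$2 \<and> v$4 = c * v$1 + e * v$2}"

definition vertical :: "('a::field ^ 4) set" where
  "vertical = {v. v$1 = 0 \<and> v$2 = 0}"

lemma pg_line_span:
  assumes "p \<notin> vec.span {q}" "q \<noteq> 0"
  shows "vec.span {p, q} \<in> pg_lines"
proof -
  have "vec.dim {p, q} = 2" using assms by (simp add: vec.dim_insert)
  then show ?thesis by (simp add: pg_lines_def)
qed

lemma graph4_in_pg_lines: "graph4 a b c e \<in> pg_lines"
proof -
  let ?p = "vec4 1 0 a c" and ?q = "vec4 0 1 b e"
  have "v \<in> vec.span {?p, ?q} \<longleftrightarrow> v \<in> graph4 a b c e" for v
    by (auto simp: vec.span_insert vec.span_singleton graph4_def vec4_eq_iff algebra_simps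
        intro: exI[of _ "v$1"])
  moreover have "?p \<notin> vec.span {?q}" by (auto simp: vec.span_singleton vec4_eq_iff)
  moreover have "?q \<noteq> 0" by (simp add: vec4_eq_iff)
  ultimately show ?thesis using pg_line_span by (metis subsetI subset_antisym)
qed

lemma vertical_in_pg_lines: "vertical \<in> pg_lines"
proof -
  let ?p = "vec4 0 0 1 0 :: 'a::field ^ 4" and ?q = "vec4 0 0 0 1 :: 'a ^ 4"
  have "v \<in> vec.span {?p, ?q} \<longleftrightarrow> v \<in> vertical" for v
    by (auto simp: vec.span_insert vec.span_singleton vertical_def vec4_eq_iff algebra_simps
        intro: exI[of _ "v$3"])
  moreover have "?p \<notin> vec.span {?q}" by (auto simp: vec.span_singleton vec4_eq_iff)
  moreover have "?q \<noteq> 0" by (simp add: vec4_eq_iff)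
  ultimately show ?thesis using pg_line_span by (metis subsetI subset_antisym)
qed

lemma orthogonal_vertical:
  assumes "r \<noteq> 0"
  shows "{v. \<forall>u\<in>vertical. r * det12 u v + det34 u v = 0} = graph4 0 0 0 (0::'a::field)" (is "?P = _")
proof
  show "graph4 0 0 0 0 \<subseteq> ?P" by (auto simp: graph4_def vertical_def det12_def det34_def)
  have "vec4 0 0 1 0 \<in> (vertical :: ('a^4) set)" "vec4 0 0 0 1 \<in> (vertical :: ('a^4) set)"
    by (auto simp: vertical_def)
  then show "?P \<subseteq> graph4 0 0 0 0"
    by (force simp: graph4_def det12_def det34_def)
qed

text \<open>The form is linear in \<open>u\<close>, so it suffices to test the vectors of the graph
  over (1, 0) and (0, 1); each yields one of the equations.\<close>

lemma orthogonal_graph4: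
  "(\<forall>u\<in>graph4 a b c e. r * det12 u v + det34 u v = 0) \<longleftrightarrow>
     r * v$2 + a * v$4 - c * v$3 = 0 \<and> r * v$1 + e * v$3 - b * v$4 = (0::'a::field)"
  (is "?l \<longleftrightarrow> ?r")
proof
  have "vec4 1 0 a c \<in> graph4 a b c e" "vec4 0 1 b e \<in> graph4 a b c e"
    by (auto simp: graph4_def)
  moreover assume ?l
  ultimately have "r * det12 (vec4 1 0 a c) v + det34 (vec4 1 0 a c) v = 0"
    "r * det12 (vec4 0 1 b e) v + det34 (vec4 0 1 b e) v = 0" by blast+
  then show ?r by (simp_all add: det12_def det34_def algebra_simps)
next
  assume r: ?r
  show ?l
  proof
    fix u assume "u \<in> graph4 a b c e"
    then have u: "u$3 = a * u$1 + b * u$2" "u$4 = c * u$1 + e * u$2" by (simp_all add: graph4_def)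
    have "r * det12 u v + det34 u v = u$1 * (r * v$2 + a * v$4 - c * v$3)
        - u$2 * (r * v$1 + e * v$3 - b * v$4)"
      unfolding det12_def det34_def u by (simp add: algebra_simps)
    then show "r * det12 u v + det34 u v = 0" using r by simp
  qed
qed

lemma orthogonal_graph4_zero:
  assumes "r \<noteq> 0"
  shows "{v. \<forall>u\<in>graph4 0 0 0 0. r * det12 u v + det34 u v = 0} = (vertical :: ('a::field^4) set)"
  unfolding orthogonal_graph4 by (use assms in \<open>auto simp: vertical_def\<close>)

text \<open>The equations of \<open>orthogonal_graph4\<close> are a linear system for
  \<open>v$3\<close> and \<open>v$4\<close> with nonzero determinant; Cramer's rule returns the
  original matrix times \<open>k\<close>.\<close>

lemma orthogonal_graph4_nonsingular:
  assumes "r \<noteq> 0" "a * e - b * c \<noteq> 0" and k: "k = - r / (a * e - b * c)"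
  shows "{v. \<forall>u\<in>graph4 a b c e. r * det12 u v + det34 u v = 0}
    = graph4 (k * a) (k * b) (k * c) (k * e :: 'a::field)"
proof (rule Set.set_eqI)
  fix v :: "'a ^ 4"
  have r: "r = - k * (a * e - b * c)" using assms by (simp add: field_simps)
  \<comment> \<open>The combinations of the two equations that eliminate \<open>v$4\<close> and
    \<open>v$3\<close>.\<close>
  have 1: "(a * e - b * c) * (v$3 - (k * a * v$1 + k * b * v$2))
        = a * (r * v$1 + e * v$3 - b * v$4) + b * (r * v$2 + a * v$4 - c * v$3)"
      "(a * e - b * c) * (v$4 - (k * c * v$1 + k * e * v$2))
        = c * (r * v$1 + e * v$3 - b * v$4) + e * (r * v$2 + a * v$4 - c * v$3)"
    unfolding r by (simp_all add: algebra_simps)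
  have "(r * v$2 + a * v$4 - c * v$3 = 0 \<and> r * v$1 + e * v$3 - b * v$4 = 0)
    \<longleftrightarrow> v \<in> graph4 (k * a) (k * b) (k * c) (k * e)" (is "?l \<longleftrightarrow> ?r")
  proof
    assume ?l
    then show ?r using 1 assms(2) by (simp add: graph4_def)
  next
    assume ?r
    then have v: "v$3 = k * a * v$1 + k * b * v$2" "v$4 = k * c * v$1 + k * e * v$2"
      by (simp_all add: graph4_def)
    show ?l unfolding r v by (simp add: algebra_simps)
  qed
  then show "v \<in> {v. \<forall>u\<in>graph4 a b c e. r * det12 u v + det34 u v = 0}
    \<longleftrightarrow> v \<in> graph4 (k * a) (k * b) (k * c) (k * e)"
    by (simp only: mem_Collect_eq orthogonal_graph4)
qed

section \<open>The Hall spread and its orthogonal lines\<close>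

lemma ex_perp_spread_form:
  fixes r :: "'a::{field,finite}"
  assumes odd: "odd CARD('a)" and r: "r \<noteq> 0"
  shows "\<exists>S. perp_spread (\<lambda>x y. r * det12 x y + det34 x y = 0) S"
proof -
  obtain d :: 'a where d: "\<And>x. x\<^sup>2 \<noteq> d" using ex_nonsquare(1)[OF odd] by blast
  \<comment> \<open>The norm form is anisotropic because \<open>d\<close> is not a square.\<close>
  have norm_0: "s = 0 \<and> t = 0" if "s * s - d * (t * t) = 0" for s t
  proof (cases "t = 0")
    case False
    with that have "(s / t)\<^sup>2 = d" by (simp add: field_simps power2_eq_square)
    with d show ?thesis by blast
  qed (use that in auto)
  have two: "(2::'a) \<noteq> 0" using ex_nonsquare(2)[OF odd] .
  \<comment> \<open>\<open>s + t * sqrt d\<close> has norm \<open>N s t\<close>; in \<open>K\<^sup>2\<close>, \<open>G s t\<close> is the line \<open>y = (s + t * sqrt d) x\<close>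
    and \<open>H s t\<close> is the line \<open>y = (s + t * sqrt d) x\<^sup>q\<close>.\<close>
  define N where "N s t = s * s - d * (t * t)" for s t
  define G where "G s t = graph4 s (d * t) t s" for s t
  define H where "H s t = graph4 s (- (d * t)) t (- s)" for s t
  define S where "S = insert vertical
    ({G s t | s t. N s t \<noteq> - r} \<union> {H s t | s t. N s t = - r})"
  have S_cases: thesis if "L \<in> S" "L = vertical \<Longrightarrow> thesis"
    "\<And>s t. L = G s t \<Longrightarrow> N s t \<noteq> - r \<Longrightarrow> thesis" "\<And>s t. L = H s t \<Longrightarrow> N s t = - r \<Longrightarrow> thesis"
    for L thesis using that unfolding S_def by blast
  have S_intros: "vertical \<in> S" "N s t \<noteq> - r \<Longrightarrow> G s t \<in> S" "N s t = - r \<Longrightarrow> H s t \<in> S" for s t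
    unfolding S_def by blast+
  have "S \<subseteq> pg_lines"
    by (auto elim!: S_cases simp: G_def H_def graph4_in_pg_lines vertical_in_pg_lines)
  moreover have "\<exists>!L. L \<in> S \<and> v \<in> L" if "v \<noteq> 0" for v
  proof -
    let ?x = "N (v$1) (v$2)" and ?y = "N (v$3) (v$4)"
    \<comment> \<open>The norm is multiplicative and unchanged by conjugation, so on either type of
      line the norm of the second half of \<open>v\<close> is \<open>N s t\<close> times that of the
      first. This ratio decides which type can contain \<open>v\<close>.\<close>
    have N_G: "?y = N s t * ?x" if "v \<in> G s t" for s t
    proof -
      from that have v: "v$3 = s * v$1 + d * t * v$2" "v$4 = t * v$1 + s * v$2"
        by (simp_all add: G_def graph4_def)
      show ?thesis unfolding N_def v by (simp add: algebra_simps)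
    qed
    have N_H: "?y = N s t * ?x" if "v \<in> H s t" for s t
    proof -
      from that have v: "v$3 = s * v$1 - d * t * v$2" "v$4 = t * v$1 - s * v$2"
        by (simp_all add: H_def graph4_def)
      show ?thesis unfolding N_def v by (simp add: algebra_simps)
    qed
    show ?thesis
    proof (cases "?x = 0")
      case True
      then have v: "v$1 = 0" "v$2 = 0" using norm_0 unfolding N_def by blast+
      show ?thesis
      proof (rule ex1I[of _ vertical])
        fix L assume "L \<in> S \<and> v \<in> L"
        then show "L = vertical"
          using v \<open>v \<noteq> 0\<close> by (auto elim!: S_cases simp: G_def H_def graph4_def vec4_eq_iff)
      qed (use v S_intros(1) vertical_def in blast)
    next
      case x: False
      then have nv: "v \<notin> vertical" unfolding N_def vertical_def by auto
      show ?thesis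
      proof (cases "?y = - r * ?x")
        case True
        have N_cancel: "N s t = - r" if "?y = N s t * ?x" for s t
        proof -
          have "N s t * ?x = - r * ?x" using that True by (rule trans[OF sym])
          then show ?thesis using x by (simp only: mult_cancel_right simp_thms)
        qed
        \<comment> \<open>\<open>s\<close> and \<open>t\<close> are the coordinates of y / x^q = x y
          / N(x) in K.\<close>
        define s where "s = (v$1 * v$3 + d * (v$2 * v$4)) / ?x"
        define t where "t = (v$1 * v$4 + v$2 * v$3) / ?x"
        have st: "?x * s = v$1 * v$3 + d * (v$2 * v$4)" "?x * t = v$1 * v$4 + v$2 * v$3"
          using x by (simp_all add: s_def t_def)
        have "?x * (s * v$1 - d * t * v$2) = (?x * s) * v$1 - d * (?x * t) * v$2"
          "?x * (t * v$1 - s * v$2) = (?x * t) * v$1 - (?x * s) * v$2"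
          by (simp_all add: algebra_simps)
        then have "?x * v$3 = ?x * (s * v$1 - d * t * v$2)" "?x * v$4 = ?x * (t * v$1 - s * v$2)"
          unfolding st by (simp_all add: N_def algebra_simps)
        then have v: "v \<in> H s t" using x by (simp add: H_def graph4_def)
        show ?thesis
        proof (rule ex1I[of _ "H s t"])
          have "N s t = - r" using N_cancel N_H[OF v] by blast
          then show "H s t \<in> S \<and> v \<in> H s t" using v S_intros by blast
        next
          fix L assume L: "L \<in> S \<and> v \<in> L"
          then have "L \<in> S" by blast
          then show "L = H s t"
          proof (rule S_cases)
            fix s' t' assume L': "L = H s' t'"
            then have v': "v$3 = s' * v$1 - d * t' * v$2" "v$4 = t' * v$1 - s' * v$2"
              using L by (simp_all add: H_def graph4_def)
            have "?x * s' = ?x * s" "?x * t' = ?x * t"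
              unfolding st v' by (simp_all add: N_def algebra_simps)
            then show ?thesis using x L' by simp
          next
            \<comment> \<open>A line of the other type would need a norm ratio different from
              \<open>- r\<close>.\<close>
            fix s' t' assume "L = G s' t'" "N s' t' \<noteq> - r"
            then show ?thesis using L N_G N_cancel by blast
          qed (use L nv in simp)
        qed
      next
        case False
        \<comment> \<open>\<open>s\<close> and \<open>t\<close> are the coordinates of y / x = y x^q
          / N(x) in K.\<close>
        define s where "s = (v$1 * v$3 - d * (v$2 * v$4)) / ?x"
        define t where "t = (v$1 * v$4 - v$2 * v$3) / ?x"
        have st: "?x * s = v$1 * v$3 - d * (v$2 * v$4)" "?x * t = v$1 * v$4 - v$2 * v$3"
          using x by (simp_all add: s_def t_def)
        have "?x * (s * v$1 + d * t * v$2) = (?x * s) * v$1 + d * (?x * t) * v$2"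
          "?x * (t * v$1 + s * v$2) = (?x * t) * v$1 + (?x * s) * v$2"
          by (simp_all add: algebra_simps)
        then have "?x * v$3 = ?x * (s * v$1 + d * t * v$2)" "?x * v$4 = ?x * (t * v$1 + s * v$2)"
          unfolding st by (simp_all add: N_def algebra_simps)
        then have v: "v \<in> G s t" using x by (simp add: G_def graph4_def)
        show ?thesis
        proof (rule ex1I[of _ "G s t"])
          have "N s t \<noteq> - r" using N_G[OF v] False by auto
          then show "G s t \<in> S \<and> v \<in> G s t" using v S_intros by blast
        next
          fix L assume L: "L \<in> S \<and> v \<in> L"
          then have "L \<in> S" by blast
          then show "L = G s t"
          proof (rule S_cases)
            fix s' t' assume L': "L = G s' t'"
            then have v': "v$3 = s' * v$1 + d * t' * v$2" "v$4 = t' * v$1 + s' * v$2"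
              using L by (simp_all add: G_def graph4_def)
            have "?x * s' = ?x * s" "?x * t' = ?x * t"
              unfolding st v' by (simp_all add: N_def algebra_simps)
            then show ?thesis using x L' by simp
          next
            fix s' t' assume "L = H s' t'" "N s' t' = - r"
            then show ?thesis using L N_H False by auto
          qed (use L nv in simp)
        qed
      qed
    qed
  qed
  moreover have "{v. \<forall>u\<in>L. r * det12 u v + det34 u v = 0} \<in> S" (is "?P L \<in> S") if "L \<in> S" for L
    using that
  proof (rule S_cases)
    assume "L = vertical"
    moreover have "G 0 0 \<in> S" using r by (intro S_intros) (simp add: N_def)
    ultimately show ?thesis using orthogonal_vertical[OF r] by (simp add: G_def)
  next
    fix s t assume L: "L = G s t" and N: "N s t \<noteq> - r"
    show ?thesis
    proof (cases "N s t = 0")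
      case True
      then have "s = 0 \<and> t = 0" unfolding N_def by (rule norm_0)
      then show ?thesis using L orthogonal_graph4_zero[OF r] S_intros(1) by (simp add: G_def)
    next
      case False
      \<comment> \<open>The matrix of \<open>G s t\<close> has determinant \<open>N s t\<close>, so
        this is the factor of \<open>orthogonal_graph4_nonsingular\<close>.\<close>
      define k where "k = - r / N s t"
      have "?P L = G (k * s) (k * t)"
      proof -
        have "s * s - d * t * t \<noteq> 0" "k = - r / (s * s - d * t * t)"
          using False by (simp_all add: N_def k_def mult.assoc)
        from orthogonal_graph4_nonsingular[OF r this] show ?thesis
          by (simp only: L G_def mult.left_commute[of d k t])
      qed
      \<comment> \<open>The new norm is k^2 N = - k r. It equals - r only for k = 1, that is for N =
        - r, so the retained lines of the regular spread are permuted.\<close>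
      moreover have "N (k * s) (k * t) \<noteq> - r"
      proof
        assume "N (k * s) (k * t) = - r"
        moreover have "N (k * s) (k * t) = k * (k * N s t)" by (simp add: N_def algebra_simps)
        moreover have "k * N s t = - r" using False by (simp add: k_def)
        ultimately have "k = 1" using r by simp
        with \<open>k * N s t = - r\<close> N show False by simp
      qed
      ultimately show ?thesis using S_intros(2) by simp
    qed
  next
    fix s t assume L: "L = H s t" and N: "N s t = - r"
    have "?P L = H (- s) (- t)"
    proof -
      \<comment> \<open>The matrix of \<open>H s t\<close> has determinant \<open>- N s t\<close>,
        which is \<open>r\<close>, so the factor is -1.\<close>
      have D: "s * - s - - (d * t) * t = r" using N unfolding N_def by (simp add: algebra_simps)
      have "s * - s - - (d * t) * t \<noteq> 0" "- 1 = - r / (s * - s - - (d * t) * t)"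
        unfolding D using r by simp_all
      from orthogonal_graph4_nonsingular[OF r this] show ?thesis by (simp add: L H_def)
    qed
    moreover have "N (- s) (- t) = - r" using N by (simp add: N_def)
    ultimately show ?thesis using S_intros(3) by simp
  qed
  moreover have "\<exists>u\<in>L. \<exists>v\<in>L. \<not> r * det12 u v + det34 u v = 0" if "L \<in> S" for L
    using that
  proof (rule S_cases)
    assume "L = vertical"
    then show ?thesis
      by (intro bexI[of _ "vec4 0 0 1 0"] bexI[of _ "vec4 0 0 0 1"])
        (simp_all add: vertical_def det12_def det34_def)
  next
    fix s t assume "L = G s t" and N: "N s t \<noteq> - r"
    \<comment> \<open>The form takes the value \<open>r + N s t\<close> on the two spanning vectors
      chosen below.\<close>
    moreover have "r + (s * s - t * (d * t)) \<noteq> 0"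
      using N by (simp add: N_def algebra_simps add_eq_0_iff)
    ultimately show ?thesis
      by (intro bexI[of _ "vec4 1 0 s t"] bexI[of _ "vec4 0 1 (d * t) s"])
        (simp_all add: G_def graph4_def det12_def det34_def)
  next
    fix s t assume "L = H s t" and N: "N s t = - r"
    \<comment> \<open>On the opposite regulus the value is \<open>r - N s t = 2 * r\<close>, nonzero
      because \<open>q\<close> is odd.\<close>
    moreover have "r + (t * (d * t) - s * s) = r - N s t" by (simp add: N_def algebra_simps)
    then have "r + (t * (d * t) - s * s) = 2 * r" by (simp add: N)
    then have "r + (t * (d * t) - s * s) \<noteq> 0" using two r by simp
    ultimately show ?thesis
      by (intro bexI[of _ "vec4 1 0 s t"] bexI[of _ "vec4 0 1 (- (d * t)) (- s)"])
        (simp_all add: H_def graph4_def det12_def det34_def)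
  qed
  ultimately have "perp_spread (\<lambda>x y. r * det12 x y + det34 x y = 0) S"
    by (simp add: perp_spread_def)
  then show ?thesis by blast
qed

section \<open>Change of coordinates for spreads\<close>

text \<open>Carries the spread found in hyperbolic coordinates back to those in which \<zeta> is
  given; \<open>T\<close> respects both incidence and orthogonality.\<close>

lemma perp_spread_image:
  assumes T: "Vector_Spaces.linear (*s) (*s) T" and bij: "bij T"
    and S: "perp_spread (\<lambda>x y. perp (T x) (T y)) S"
  shows "perp_spread perp ((`) T ` S)"
proof -
  interpret T: Vector_Spaces.linear "(*s)" "(*s)" T by (fact T)
  have inj: "inj T" using bij by (rule bij_is_inj)
  have "T ` L \<in> pg_lines" if "L \<in> S" for L
  proof -
    have "L \<in> pg_lines" using that S by (auto simp: perp_spread_def)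
    then show ?thesis
      using vec.dim_image_eq[OF T inj_on_subset[OF inj subset_UNIV], of L] T.subspace_image
      by (simp add: pg_lines_def)
  qed
  moreover have "\<exists>!M. M \<in> (`) T ` S \<and> v \<in> M" if "v \<noteq> 0" for v
  proof -
    obtain w where w: "v = T w" using bij by (metis bij_pointE)
    with that have "w \<noteq> 0" using T.zero by blast
    then have ex1: "\<exists>!L. L \<in> S \<and> w \<in> L" using S by (simp add: perp_spread_def)
    then obtain L where L: "L \<in> S" "w \<in> L" by blast
    show ?thesis
    proof (rule ex1I[of _ "T ` L"])
      fix M assume M: "M \<in> (`) T ` S \<and> v \<in> M"
      then obtain K where K: "K \<in> S" "M = T ` K" by auto
      with M w have "w \<in> K" by (simp add: inj_image_mem_iff[OF inj])
      with ex1 K(1) L have "K = L" by auto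
      with K(2) show "M = T ` L" by simp
    qed (use L w in auto)
  qed
  moreover have "{v. \<forall>u\<in>T ` L. perp u v} = T ` {v. \<forall>u\<in>L. perp (T u) (T v)}" for L
  proof (rule Set.set_eqI)
    fix v
    obtain w where "v = T w" using bij by (metis bij_pointE)
    then show "v \<in> {v. \<forall>u\<in>T ` L. perp u v} \<longleftrightarrow> v \<in> T ` {v. \<forall>u\<in>L. perp (T u) (T v)}"
      by (simp add: inj_image_mem_iff[OF inj])
  qed
  moreover have "{v. \<forall>u\<in>L. perp (T u) (T v)} \<in> S \<and> (\<exists>u\<in>L. \<exists>v\<in>L. \<not> perp (T u) (T v))"
    if "L \<in> S" for L using S that by (simp add: perp_spread_def)
  ultimately show ?thesis unfolding perp_spread_def by (simp add: image_subset_iff)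
qed

section \<open>Between a polarity of subspaces and its relation on vectors\<close>

lemma span_singleton_subset_iff: "vec.subspace U \<Longrightarrow> vec.span {v} \<subseteq> U \<longleftrightarrow> v \<in> U"
  using vec.span_base[of v "{v}"] vec.span_minimal[of "{v}" U] by auto

lemma pg_pointE:
  assumes "x \<in> pg_points"
  obtains v where "v \<noteq> 0" "x = vec.span {v}"
proof -
  obtain v where v: "v \<in> x" "v \<noteq> 0"
  proof -
    have "\<not> x \<subseteq> {0}"
      using assms vec.dim_eq_0[of x] unfolding pg_points_def by auto
    then show ?thesis using that by blast
  qed
  moreover have "vec.span {v} = x"
    using assms v by (intro vec.subspace_dim_equal) (auto simp: pg_points_def span_singleton_subset_iff)
  ultimately show ?thesis using that by blast
qed

lemma span_in_pg_points: "v \<noteq> 0 \<Longrightarrow> vec.span {v} \<in> pg_points"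
  by (simp add: pg_points_def)

text \<open>Symmetry holds because \<zeta> is an involution reversing inclusion, and nondegeneracy
  because \<open>\<zeta> {0} = UNIV\<close>. A point is a minimal nonzero subspace, so its image is
  a maximal proper one; this gives \<open>hyperplane\<close>.\<close>

lemma symplectic_polarity_null_relation:
  assumes \<zeta>: "symplectic_polarity \<zeta>"
  shows "null_relation (\<lambda>x y. y \<in> \<zeta> (vec.span {x}))"
proof -
  have pol: "polarity \<zeta>" and self: "\<And>x. x \<in> pg_points \<Longrightarrow> x \<subseteq> \<zeta> x"
    using \<zeta> by (auto simp: symplectic_polarity_def)
  have sub: "vec.subspace (\<zeta> U)" if "vec.subspace U" for U
    using that pol by (auto simp: polarity_def bij_betw_def)
  have anti: "\<zeta> W \<subseteq> \<zeta> U \<longleftrightarrow> U \<subseteq> W" if "vec.subspace U" "vec.subspace W" for U W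
    using that pol by (auto simp: polarity_def)
  have inv: "\<zeta> (\<zeta> U) = U" if "vec.subspace U" for U
    using that pol by (auto simp: polarity_def)
  have zero: "\<zeta> {0} = UNIV"
  proof -
    have "\<zeta> (\<zeta> UNIV) \<subseteq> \<zeta> {0}"
      by (subst anti) (auto simp: sub vec.subspace_0)
    then show ?thesis by (simp add: inv top.extremum_unique)
  qed
  show ?thesis
  proof
    show "x \<in> \<zeta> (vec.span {y})" if "y \<in> \<zeta> (vec.span {x})" for x y
    proof -
      have "vec.span {y} \<subseteq> \<zeta> (vec.span {x})" using that by (simp add: span_singleton_subset_iff sub)
      then have "\<zeta> (\<zeta> (vec.span {x})) \<subseteq> \<zeta> (vec.span {y})" by (simp add: anti sub)
      then show ?thesis by (simp add: inv span_singleton_subset_iff sub)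
    qed
    show "x \<in> \<zeta> (vec.span {x})" for x
    proof (cases "x = 0")
      case False
      then show ?thesis
        using self[OF span_in_pg_points] by (simp add: span_singleton_subset_iff sub)
    qed (simp add: vec.subspace_0 sub)
    show "vec.subspace {y. y \<in> \<zeta> (vec.span {x})}" for x by (simp add: sub)
    show "\<exists>y. y \<notin> \<zeta> (vec.span {x})" if "x \<noteq> 0" for x
    proof (rule ccontr)
      assume "\<nexists>y. y \<notin> \<zeta> (vec.span {x})"
      then have "\<zeta> {0} \<subseteq> \<zeta> (vec.span {x})" by auto
      then have "vec.span {x} \<subseteq> {0}" by (subst (asm) anti) auto
      with that show False by (simp add: span_singleton_subset_iff)
    qed
    show "\<exists>c. y - c *s z \<in> \<zeta> (vec.span {x})" if z: "z \<notin> \<zeta> (vec.span {x})" for x y z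
    proof -
      \<comment> \<open>\<zeta> maps \<open>?W\<close> into the span of \<open>x\<close> but to a
        subspace missing \<open>x\<close>, hence to zero. So \<open>?W\<close> is the whole space
        and \<open>y\<close> is a multiple of \<open>z\<close> modulo \<open>?H\<close>.\<close>
      let ?H = "\<zeta> (vec.span {x})" and ?W = "vec.span (insert z (\<zeta> (vec.span {x})))"
      have H: "vec.subspace ?H" by (simp add: sub)
      have "?H \<subseteq> ?W" by (meson order_trans subset_insertI vec.span_superset)
      then have "\<zeta> ?W \<subseteq> \<zeta> ?H" by (simp add: anti sub)
      then have W: "\<zeta> ?W \<subseteq> vec.span {x}" by (simp add: inv)
      have "\<zeta> ?W \<subseteq> {0}"
      proof
        fix w assume w: "w \<in> \<zeta> ?W"
        then obtain c where c: "w = c *s x" using W by (auto simp: vec.span_singleton)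
        have "x \<notin> \<zeta> ?W"
        proof
          assume "x \<in> \<zeta> ?W"
          then have "\<zeta> (\<zeta> ?W) \<subseteq> ?H" by (simp add: anti sub span_singleton_subset_iff)
          then have "?W \<subseteq> ?H" by (simp add: inv)
          with z vec.span_base[of z "insert z ?H"] show False by blast
        qed
        moreover have "x = inverse c *s w" if "c \<noteq> 0" using c that by (simp add: vector_smult_assoc)
        ultimately have "c = 0"
          using w vec.subspace_scale[OF sub[OF vec.subspace_span]] by metis
        then show "w \<in> {0}" using c by simp
      qed
      then have "\<zeta> {0} \<subseteq> \<zeta> (\<zeta> ?W)" by (simp add: anti sub)
      then have "y \<in> ?W" by (auto simp: zero inv)
      then show ?thesis using vec.span_eq_iff[THEN iffD2, OF H] by (simp add: vec.span_breakdown_eq)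
    qed
  qed
qed

text \<open>The partner of \<open>L\<close> is its set of orthogonal vectors, a spread line by
  assumption. It is unique because any spread line inside it shares a nonzero vector with
  it.\<close>

lemma special_spread_if_perp_spread:
  assumes \<zeta>: "symplectic_polarity \<zeta>" and S: "perp_spread (\<lambda>x y. y \<in> \<zeta> (vec.span {x})) S"
  shows "special_spread \<zeta> S"
proof -
  have pol: "polarity \<zeta>" using \<zeta> by (auto simp: symplectic_polarity_def)
  have sub: "vec.subspace (\<zeta> U)" if "vec.subspace U" for U
    using that pol by (auto simp: polarity_def bij_betw_def)
  have anti: "\<zeta> W \<subseteq> \<zeta> U" if "vec.subspace U" "vec.subspace W" "U \<subseteq> W" for U W
    using that pol by (auto simp: polarity_def)
  have lines: "S \<subseteq> pg_lines" using S unfolding perp_spread_def by blast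
  then have line_sub: "vec.subspace L" if "L \<in> S" for L using that by (auto simp: pg_lines_def)
  have ex1: "\<exists>!L. L \<in> S \<and> v \<in> L" if "v \<noteq> 0" for v using that S unfolding perp_spread_def by blast
  let ?P = "\<lambda>L. {v. \<forall>u\<in>L. v \<in> \<zeta> (vec.span {u})}"
  have P: "?P L \<in> S" "\<exists>u\<in>L. \<exists>v\<in>L. v \<notin> \<zeta> (vec.span {u})" if "L \<in> S" for L
    using S that unfolding perp_spread_def by blast+
  have orth: "(\<forall>x\<in>pg_points. \<forall>y\<in>pg_points. x \<subseteq> L \<longrightarrow> y \<subseteq> M \<longrightarrow> orthogonal_points \<zeta> x y)
      \<longleftrightarrow> M \<subseteq> ?P L" (is "?l \<longleftrightarrow> ?r") if "L \<in> S" "M \<in> S" for L M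
  proof
    assume l: ?l
    show ?r
    proof clarify
      fix u v assume uv: "v \<in> M" "u \<in> L"
      \<comment> \<open>A zero vector spans no point, so it is treated separately.\<close>
      show "v \<in> \<zeta> (vec.span {u})"
      proof (cases "u = 0 \<or> v = 0")
        case True
        interpret null_relation "\<lambda>x y. y \<in> \<zeta> (vec.span {x})"
          by (rule symplectic_polarity_null_relation[OF \<zeta>])
        have "0 \<in> \<zeta> (vec.span {w})" for w by (simp add: sub vec.subspace_0)
        with True show ?thesis using perp_sym by blast
      next
        case False
        then have "orthogonal_points \<zeta> (vec.span {u}) (vec.span {v})"
          using l uv that by (simp add: span_in_pg_points span_singleton_subset_iff line_sub)
        then show ?thesis by (simp add: orthogonal_points_def span_singleton_subset_iff sub)
      qed
    qed
  next
    assume r: ?r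
    show ?l
    proof (intro ballI impI)
      fix x y assume xy: "x \<in> pg_points" "y \<in> pg_points" "x \<subseteq> L" "y \<subseteq> M"
      obtain u v where uv: "x = vec.span {u}" "y = vec.span {v}" using xy(1,2) by (meson pg_pointE)
      then have "u \<in> L" "v \<in> M" using xy(3,4) that by (simp_all add: span_singleton_subset_iff line_sub)
      then show "orthogonal_points \<zeta> x y"
        using r uv by (auto simp: orthogonal_points_def span_singleton_subset_iff sub)
    qed
  qed
  have "\<exists>!L. L \<in> S \<and> x \<subseteq> L" if x: "x \<in> pg_points" for x
  proof -
    obtain v where v: "v \<noteq> 0" "x = vec.span {v}" using x by (rule pg_pointE)
    have "L \<in> S \<and> x \<subseteq> L \<longleftrightarrow> L \<in> S \<and> v \<in> L" for L
      using span_singleton_subset_iff[OF line_sub] v(2) by blast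
    then show ?thesis using ex1[OF v(1)] by simp
  qed
  then have "spread S" using lines by (simp add: spread_def)
  moreover have "\<not> totally_isotropic \<zeta> L" if L: "L \<in> S" for L
  proof
    assume ti: "totally_isotropic \<zeta> L"
    \<comment> \<open>If \<zeta> fixes \<open>L\<close>, then \<open>L\<close> lies in the image of
      each of its points, so all its vectors are orthogonal.\<close>
    have "v \<in> \<zeta> (vec.span {u})" if "u \<in> L" "v \<in> L" for u v
    proof -
      have "\<zeta> L \<subseteq> \<zeta> (vec.span {u})"
        using that L by (intro anti) (simp_all add: line_sub span_singleton_subset_iff)
      with ti that show ?thesis by (auto simp: totally_isotropic_def)
    qed
    with P(2)[OF L] show False by blast
  qed
  moreover have "\<exists>!M. M \<in> S \<and> M \<subseteq> ?P L" if L: "L \<in> S" for L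
  proof (rule ex1I[of _ "?P L"])
    fix M assume M: "M \<in> S \<and> M \<subseteq> ?P L"
    then have "vec.dim M = 2" using lines by (auto simp: pg_lines_def)
    then obtain v where "v \<in> M" "v \<noteq> 0" using vec.dim_eq_0[of M] by force
    with M ex1[of v] P(1)[OF L] show "M = ?P L" by blast
  qed (use P(1)[OF L] in blast)
  then have "\<exists>!M. M \<in> S \<and>
      (\<forall>x\<in>pg_points. \<forall>y\<in>pg_points. x \<subseteq> L \<longrightarrow> y \<subseteq> M \<longrightarrow> orthogonal_points \<zeta> x y)"
    if L: "L \<in> S" for L
    using L orth[OF L] by (simp cong: conj_cong)
  ultimately show ?thesis unfolding special_spread_def by blast
qed

theorem theorem3:
  fixes q :: nat and \<zeta> :: "('a::{field,finite} ^ 4) set \<Rightarrow> ('a ^ 4) set"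
  assumes "primepow q" and "odd q"
    and "CARD('a) = q"
    and "symplectic_polarity \<zeta>"
  shows "\<exists>S. special_spread \<zeta> S"
proof -
  let ?perp = "\<lambda>x y. y \<in> \<zeta> (vec.span {x})"
  interpret null_relation ?perp
    by (rule symplectic_polarity_null_relation[OF assms(4)])
  obtain T where T: "Vector_Spaces.linear (*s) (*s) T" "bij T"
    and hyp: "\<And>x y. x$3 = 0 \<Longrightarrow> x$4 = 0 \<Longrightarrow> y$1 = 0 \<Longrightarrow> y$2 = 0 \<Longrightarrow> ?perp (T x) (T y)"
      "\<not> ?perp (T (vec4 1 0 0 0)) (T (vec4 0 1 0 0))"
      "\<not> ?perp (T (vec4 0 0 1 0)) (T (vec4 0 0 0 1))"
    using ex_hyperbolic_basis by auto
  \<comment> \<open>Pulled back along \<open>T\<close>, the relation has the standard basis as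
    hyperbolic basis.\<close>
  interpret H: hyperbolic_null_relation "\<lambda>x y. ?perp (T x) (T y)"
    by (intro hyperbolic_null_relation.intro hyperbolic_null_relation_axioms.intro pullback T hyp)
  obtain r where r: "r \<noteq> 0" "\<And>x y. ?perp (T x) (T y) \<longleftrightarrow> r * det12 x y + det34 x y = 0"
    using H.ex_form by blast
  obtain S where "perp_spread (\<lambda>x y. r * det12 x y + det34 x y = 0) S"
    using ex_perp_spread_form[OF _ r(1)] assms(2,3) by blast
  then have "perp_spread (\<lambda>x y. ?perp (T x) (T y)) S" by (simp only: r(2))
  then have "perp_spread ?perp ((`) T ` S)" by (rule perp_spread_image[OF T])
  then show ?thesis using special_spread_if_perp_spread[OF assms(4)] by blast
qed

end
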